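(* Let $k,d,\ell$ be integers with $1\le d\le k-1$ and $0\le \ell\le k-1$. Then: (i) if $d\le \ell+1$ then $g(k,d,\ell)\le \frac{1}{d+1}$, and if $d\ge \ell+1$ then $g(k,d,\ell)\le \frac{1}{\ell+2}$; (ii) if $d>1$ then $\left\lfloor \frac{2^{k-d}}{3}\right\rfloor 2^{d-k}\le g(k,d,1)<\frac13$.
   Context: A $k$-graph $H$ is a $k$-uniform hypergraph: a finite vertex set $V(H)$ with edge set $E(H)\subseteq\binom{V(H)}{k}$. For $1\le d\le k-1$, $\deg_H(S)$ is the number of edges containing a $d$-set $S\subseteq V(H)$, and $\delta_d(H)=\min\deg_H(S)$ over all $d$-subsets $S$ of $V(H)$. Construction: let $0\le \ell\le k-1$, $j\in\{0,1,\dots,\ell+1\}$, $n\equiv \ell \pmod k$, and let $x\in[0,1]$ be a real number such that $xn$ is an integer with $xn\equiv \lfloor n/k\rfloor j+\ell+1 \pmod{\ell+2}$. Let $V$ be an $n$-set with a partition $V=V_1\cup V_2$, $|V_1|=xn$. $H_\ell^j(x)$ is the $k$-graph on $V$ whose edges are all $k$-sets $e$ with $|e\cap V_1|\equiv j \pmod{\ell+2}$. Define $$g(k,d,\ell):=\lim_{n\to\infty}\left(\max_{0\le j\le \ell+1}\max_{x}\ \delta_d(H_\ell^j(x))\Big/\binom{n-d}{k-d}\right),$$ where $n$ runs over integers $n\equiv \ell\pmod k$ and $x$ over the admissible values in $[0,1]$. *)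

theory Defs
  imports Complex_Main "HOL-Number_Theory.Cong"
begin

definition k_graph :: "nat \<Rightarrow> 'a set \<Rightarrow> 'a set set \<Rightarrow> bool" where
  "k_graph k V E \<longleftrightarrow> finite V \<and> (\<forall>e\<in>E. e \<subseteq> V \<and> card e = k)"

definition degree :: "'a set set \<Rightarrow> 'a set \<Rightarrow> nat" where
  "degree E S = card {e \<in> E. S \<subseteq> e}"

definition min_degree :: "nat \<Rightarrow> 'a set \<Rightarrow> 'a set set \<Rightarrow> nat" where
  "min_degree d V E = Min (degree E ` {S. S \<subseteq> V \<and> card S = d})"

text \<open>The vertex partition is \<open>V = V1 \<union> (V - V1)\<close>.\<close>

definition part_edges :: "nat \<Rightarrow> nat \<Rightarrow> nat \<Rightarrow> 'a set \<Rightarrow> 'a set \<Rightarrow> 'a set set" where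
  "part_edges k l j V V1 =
     {e. e \<subseteq> V \<and> card e = k \<and> [card (e \<inter> V1) = j] (mod (l + 2))}"

lemma k_graph_part_edges: "finite V \<Longrightarrow> k_graph k V (part_edges k l j V V1)"
  by (auto simp: k_graph_def part_edges_def)

definition admissible :: "nat \<Rightarrow> nat \<Rightarrow> nat \<Rightarrow> nat \<Rightarrow> real set" where
  "admissible k l j n =
     {x. 0 \<le> x \<and> x \<le> 1 \<and>
         (\<exists>a::nat. x * real n = real a \<and> [a = (n div k) * j + l + 1] (mod (l + 2)))}"

text \<open>Up to isomorphism the construction depends only on \<open>n\<close> and on the size \<open>x * n\<close> of the
  first part, so the vertex set is taken to be \<open>{..<n}\<close> and the first part an initial segment.
  For admissible \<open>x\<close> the floor below is exact.\<close>

definition H_edges :: "nat \<Rightarrow> nat \<Rightarrow> nat \<Rightarrow> nat \<Rightarrow> real \<Rightarrow> nat set set" where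
  "H_edges k l j n x = part_edges k l j {..<n} {..<nat \<lfloor>x * real n\<rfloor>}"

text \<open>For \<open>l < k \<le> n\<close> all maxima and minima below are over finite nonempty sets of values and the
  binomial coefficient is nonzero; the finitely many \<open>n < k\<close> do not affect the limit.\<close>

definition max_min_degree :: "nat \<Rightarrow> nat \<Rightarrow> nat \<Rightarrow> nat \<Rightarrow> nat" where
  "max_min_degree k d l n =
     (MAX j\<in>{0..l + 1}. MAX x\<in>admissible k l j n. min_degree d {..<n} (H_edges k l j n x))"

definition g :: "nat \<Rightarrow> nat \<Rightarrow> nat \<Rightarrow> real" where
  "g k d l =
     Lim (inf sequentially (principal {n. [n = l] (mod k)}))
       (\<lambda>n. real (max_min_degree k d l n) / real ((n - d) choose (k - d)))"

end

theory Submission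
  imports Defs "HOL-Analysis.Uniform_Limit"
begin

text \<open>A \<open>d\<close>-set with \<open>i\<close> vertices in the first part has relative degree converging, uniformly in
  \<open>x\<close>, to the probability that a binomial variable with parameters \<open>k - d\<close> and \<open>x\<close> is congruent to
  \<open>j - i\<close> modulo \<open>l + 2\<close>. The congruence on \<open>x n\<close> excludes the degenerate partitions at \<open>x = 0\<close> and
  \<open>x = 1\<close>, so \<open>g\<close> is the maximum over \<open>j\<close> and \<open>x\<close> of the minimum over \<open>0 \<le> i \<le> d\<close> of these
  probabilities. Up to \<open>l + 2\<close> of them belong to distinct residues and sum to at most 1, which gives (i).
  For \<open>l = 1\<close> the sum of squared differences of the three residue probabilities is
  \<open>2 (3 x\<^sup>2 - 3 x + 1) ^ (k - d)\<close>. It is positive, so they are never all equal to \<open>1 / 3\<close>; at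
  \<open>x = 1 / 2\<close> it says that the three integers \<open>2 ^ (k - d)\<close> times the probabilities differ by at most 1.\<close>

section \<open>Residues of binomial variables\<close>

text \<open>The expectation of \<open>f\<close> under the binomial distribution, written as a
  polynomial in \<open>x\<close>. Identities for it therefore hold for every real \<open>x\<close>;
  only order statements need \<open>x\<close> in the unit interval.\<close>

definition binomial_mean :: "nat \<Rightarrow> real \<Rightarrow> (nat \<Rightarrow> real) \<Rightarrow> real" where
  "binomial_mean N x f = (\<Sum>t\<le>N. real (N choose t) * x ^ t * (1 - x) ^ (N - t) * f t)"

lemma binomial_mean_0 [simp]: "binomial_mean 0 x f = f 0"
  by (simp add: binomial_mean_def)

text \<open>Condition on one trial: failure leaves the count alone, success raises it by one.
  Algebraically this is Pascal's rule. It is the recurrence behind the inductions on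
  \<open>N\<close>.\<close>

lemma binomial_mean_Suc:
  "binomial_mean (Suc N) x f
     = (1 - x) * binomial_mean N x f + x * binomial_mean N x (\<lambda>t. f (Suc t))"
proof -
  define y where "y = 1 - x"
  \<comment> \<open>The term at \<open>t = N\<close> vanishes because \<open>N choose Suc N\<close>
    is 0.\<close>
  have A: "(\<Sum>t\<le>N. real (N choose Suc t) * x ^ Suc t * y ^ (N - t) * f (Suc t))
      = (\<Sum>t<N. real (N choose Suc t) * x ^ Suc t * y ^ (N - t) * f (Suc t))"
    by (simp add: lessThan_Suc_atMost [symmetric])
  have B: "y * (\<Sum>t\<le>N. real (N choose t) * x ^ t * y ^ (N - t) * f t)
      = y ^ Suc N * f 0 + (\<Sum>t<N. real (N choose Suc t) * x ^ Suc t * y ^ (N - t) * f (Suc t))"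
  proof -
    have "y * (\<Sum>t\<le>N. real (N choose t) * x ^ t * y ^ (N - t) * f t)
      = y ^ Suc N * f 0 + (\<Sum>t<N. y * (real (N choose Suc t) * x ^ Suc t * y ^ (N - Suc t) * f (Suc t)))"
      by (simp add: sum.atMost_shift sum_distrib_left algebra_simps)
    also have "(\<Sum>t<N. y * (real (N choose Suc t) * x ^ Suc t * y ^ (N - Suc t) * f (Suc t)))
      = (\<Sum>t<N. real (N choose Suc t) * x ^ Suc t * y ^ (N - t) * f (Suc t))"
    proof (rule sum.cong)
      fix t assume "t \<in> {..<N}"
      hence "y ^ (N - t) = y * y ^ (N - Suc t)"
        by (metis Suc_diff_Suc lessThan_iff power_Suc)
      thus "y * (real (N choose Suc t) * x ^ Suc t * y ^ (N - Suc t) * f (Suc t))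
          = real (N choose Suc t) * x ^ Suc t * y ^ (N - t) * f (Suc t)"
        by simp
    qed simp
    finally show ?thesis .
  qed
  have "(\<Sum>t\<le>Suc N. real (Suc N choose t) * x ^ t * y ^ (Suc N - t) * f t)
     = y ^ Suc N * f 0 + (\<Sum>t\<le>N. real (Suc N choose Suc t) * x ^ Suc t * y ^ (N - t) * f (Suc t))"
    by (subst sum.atMost_Suc_shift) simp
  also have "(\<Sum>t\<le>N. real (Suc N choose Suc t) * x ^ Suc t * y ^ (N - t) * f (Suc t))
     = x * (\<Sum>t\<le>N. real (N choose t) * x ^ t * y ^ (N - t) * f (Suc t))
       + (\<Sum>t\<le>N. real (N choose Suc t) * x ^ Suc t * y ^ (N - t) * f (Suc t))"
    unfolding sum_distrib_left sum.distrib [symmetric]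
    by (intro sum.cong) (simp_all add: algebra_simps)
  finally show ?thesis
    unfolding binomial_mean_def y_def [symmetric] using A B by simp
qed

lemma binomial_mean_sum:
  "binomial_mean N x (\<lambda>t. \<Sum>i\<in>I. f i t) = (\<Sum>i\<in>I. binomial_mean N x (f i))"
  unfolding binomial_mean_def sum_distrib_left by (rule sum.swap)

lemma binomial_mean_const [simp]: "binomial_mean N x (\<lambda>_. c) = c"
  by (induction N) (simp_all add: binomial_mean_Suc algebra_simps)

lemma binomial_mean_mono:
  assumes "0 \<le> x" "x \<le> 1" "\<And>t. t \<le> N \<Longrightarrow> f t \<le> h t"
  shows "binomial_mean N x f \<le> binomial_mean N x h"
  unfolding binomial_mean_def using assms
  by (intro sum_mono mult_left_mono) auto

lemma binomial_mean_at_0: "binomial_mean N 0 f = f 0"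
  by (induction N) (simp_all add: binomial_mean_Suc)

lemma binomial_mean_at_1: "binomial_mean N 1 f = f N"
  by (induction N arbitrary: f) (simp_all add: binomial_mean_Suc)

lemma continuous_on_binomial_mean: "continuous_on A (\<lambda>x. binomial_mean N x f)"
  unfolding binomial_mean_def by (intro continuous_intros)

text \<open>The limiting relative degree of a \<open>d\<close>-set having \<open>i\<close> vertices in the first part, when
  the first part has relative size \<open>x\<close>, \<open>m = l + 2\<close> and \<open>N = k - d\<close>.\<close>

definition residue_prob :: "nat \<Rightarrow> nat \<Rightarrow> nat \<Rightarrow> nat \<Rightarrow> real \<Rightarrow> real" where
  "residue_prob m N i j x = binomial_mean N x (\<lambda>t. of_bool [t + i = j] (mod m))"

lemma continuous_on_residue_prob: "continuous_on A (residue_prob m N i j)"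
  unfolding residue_prob_def by (rule continuous_on_binomial_mean)

lemma residue_prob_nonneg: "0 \<le> x \<Longrightarrow> x \<le> 1 \<Longrightarrow> 0 \<le> residue_prob m N i j x"
  using binomial_mean_mono [of x N "\<lambda>_. 0"] by (simp add: residue_prob_def)

lemma residue_prob_0 [simp]: "residue_prob m 0 i j x = of_bool [i = j] (mod m)"
  by (simp add: residue_prob_def)

lemma residue_prob_Suc:
  "residue_prob m (Suc N) i j x
     = (1 - x) * residue_prob m N i j x + x * residue_prob m N (Suc i) j x"
  by (simp add: residue_prob_def binomial_mean_Suc)

lemma residue_prob_add_modulus: "residue_prob m N (i + m) j x = residue_prob m N i j x"
proof -
  have "[t + (i + m) = j] (mod m) = [t + i = j] (mod m)" for t
    by (simp add: cong_def flip: add.assoc)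
  thus ?thesis by (simp add: residue_prob_def)
qed

text \<open>For a fixed outcome \<open>t\<close>, at most one \<open>i \<le> D < m\<close> satisfies
  the congruence, so the events are disjoint; taking the mean of their number gives the
  bound.\<close>

lemma sum_residue_prob_le_1:
  assumes "0 \<le> x" "x \<le> 1" "D < m"
  shows "(\<Sum>i\<le>D. residue_prob m N i j x) \<le> 1"
proof -
  have "(\<Sum>i\<le>D. of_bool [t + i = j] (mod m) :: real) \<le> 1" for t
  proof -
    let ?I = "{i. i \<le> D \<and> [t + i = j] (mod m)}"
    have eq: "a = b" if "a \<in> ?I" "b \<in> ?I" for a b
    proof -
      have "[t + a = t + b] (mod m)"
        using that cong_sym cong_trans by blast
      hence "[a = b] (mod m)" by (simp add: cong_add_lcancel_nat)
      thus ?thesis using that assms(3) by (simp add: cong_def)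
    qed
    have "card ?I \<le> Suc 0"
      by (subst card_le_Suc0_iff_eq) (use eq in auto)
    moreover have "(\<Sum>i\<le>D. of_bool [t + i = j] (mod m) :: real) = real (card ?I)"
      by (simp add: sum.If_cases of_bool_def Int_def)
    ultimately show ?thesis by simp
  qed
  hence "binomial_mean N x (\<lambda>t. \<Sum>i\<le>D. of_bool [t + i = j] (mod m))
      \<le> binomial_mean N x (\<lambda>_. 1)"
    using assms by (intro binomial_mean_mono)
  thus ?thesis unfolding binomial_mean_sum binomial_mean_const residue_prob_def .
qed

section \<open>Three residue classes\<close>

text \<open>One trial acts on the triple of probabilities by a circulant matrix. This preserves the
  sum and multiplies the sum of squared differences by
  \<open>|1 - x + x w|^2 = 3 x^2 - 3 x + 1\<close>, where \<open>w\<close> is a primitive cube root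
  of unity.\<close>

lemma residue_prob_mod_3:
  fixes x :: real and j :: nat
  defines "p \<equiv> \<lambda>N i. residue_prob 3 N i j x"
  shows "p N i + p N (i + 1) + p N (i + 2) = 1"
    and "(p N i - p N (i + 1))\<^sup>2 + (p N (i + 1) - p N (i + 2))\<^sup>2 + (p N (i + 2) - p N i)\<^sup>2
           = 2 * (3 * x\<^sup>2 - 3 * x + 1) ^ N"
proof -
  have rec: "p (Suc N) i = (1 - x) * p N i + x * p N (i + 1)" for N i
    by (simp add: p_def residue_prob_Suc)
  have per: "p N (i + 3) = p N i" for N i
    by (simp add: p_def residue_prob_add_modulus)
  \<comment> \<open>With no trials the triple is a unit vector, which has sum 1 and sum of squared
    differences 2.\<close>
  have base: "(p 0 i, p 0 (i + 1), p 0 (i + 2)) \<in> {(1, 0, 0), (0, 1, 0), (0, 0, 1)}"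
  proof -
    have "(i + 1) mod 3 = (i mod 3 + 1) mod 3" "(i + 2) mod 3 = (i mod 3 + 2) mod 3"
      by presburger+
    moreover have "i mod 3 \<in> {0, 1, 2}" "j mod 3 \<in> {0, 1, 2}" by auto
    ultimately show ?thesis
      unfolding p_def residue_prob_0 cong_def by auto
  qed
  show "p N i + p N (i + 1) + p N (i + 2) = 1"
  proof (induction N)
    case 0
    show ?case using base by auto
  next
    case (Suc N)
    have "p (Suc N) i + p (Suc N) (i + 1) + p (Suc N) (i + 2)
        = (1 - x) * (p N i + p N (i + 1) + p N (i + 2))
          + x * (p N (i + 1) + p N (i + 2) + p N (i + 3))"
      by (simp add: rec algebra_simps numeral_eq_Suc)
    also have "\<dots> = 1" using Suc by (simp add: per algebra_simps)
    finally show ?case .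
  qed
  show "(p N i - p N (i + 1))\<^sup>2 + (p N (i + 1) - p N (i + 2))\<^sup>2 + (p N (i + 2) - p N i)\<^sup>2
           = 2 * (3 * x\<^sup>2 - 3 * x + 1) ^ N"
  proof (induction N)
    case 0
    show ?case using base by auto
  next
    case (Suc N)
    define a b c where "a = p N i" "b = p N (i + 1)" "c = p N (i + 2)"
    have "p (Suc N) i = (1 - x) * a + x * b" "p (Suc N) (i + 1) = (1 - x) * b + x * c"
      "p (Suc N) (i + 2) = (1 - x) * c + x * a"
      using per [of N i] by (simp_all add: rec a_b_c_def numeral_eq_Suc)
    hence "(p (Suc N) i - p (Suc N) (i + 1))\<^sup>2 + (p (Suc N) (i + 1) - p (Suc N) (i + 2))\<^sup>2
        + (p (Suc N) (i + 2) - p (Suc N) i)\<^sup>2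
        = (3 * x\<^sup>2 - 3 * x + 1) * ((a - b)\<^sup>2 + (b - c)\<^sup>2 + (c - a)\<^sup>2)"
      by (simp only:) (simp add: power2_eq_square algebra_simps)
    thus ?case using Suc by (simp add: a_b_c_def)
  qed
qed

text \<open>Three numbers that are at least 1/3 and sum to 1 are all equal, so their squared
  differences would vanish; completing the square shows that \<open>3 x^2 - 3 x + 1\<close> is at
  least 1/4.\<close>

lemma residue_prob_mod_3_lt:
  assumes "\<And>i. i \<le> 2 \<Longrightarrow> c \<le> residue_prob 3 N i j x"
  shows "c < 1 / 3"
proof (rule ccontr)
  assume "\<not> c < 1 / 3"
  define p where "p = (\<lambda>i. residue_prob 3 N i j x)"
  have "p 0 \<ge> 1 / 3" "p 1 \<ge> 1 / 3" "p 2 \<ge> 1 / 3"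
    using assms [of 0] assms [of 1] assms [of 2] \<open>\<not> c < 1 / 3\<close> by (auto simp: p_def)
  moreover have "p 0 + p 1 + p 2 = 1"
    using residue_prob_mod_3(1) [of N 0 j x] by (simp add: p_def numeral_2_eq_2)
  ultimately have "p 0 = 1 / 3" "p 1 = 1 / 3" "p 2 = 1 / 3" by linarith+
  moreover have "(p 0 - p 1)\<^sup>2 + (p 1 - p 2)\<^sup>2 + (p 2 - p 0)\<^sup>2 = 2 * (3 * x\<^sup>2 - 3 * x + 1) ^ N"
    using residue_prob_mod_3(2) [of N 0 j x] by (simp add: p_def numeral_2_eq_2)
  ultimately have "(3 * x\<^sup>2 - 3 * x + 1) ^ N = 0" by (simp only:) simp
  moreover have "3 * x\<^sup>2 - 3 * x + 1 = 3 * (x - 1 / 2)\<^sup>2 + 1 / 4"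
    by (simp add: power2_eq_square algebra_simps)
  hence "3 * x\<^sup>2 - 3 * x + 1 > 0"
    by (smt (verit) zero_le_power2 divide_pos_pos zero_less_numeral)
  ultimately show False by simp
qed

text \<open>Scaling by \<open>2 ^ N\<close> turns the probabilities into integers \<open>c\<close>,
  and the factor \<open>(1 / 4) ^ N\<close> from the squared differences cancels exactly, leaving 2.
  Integrality then forces the three counts to be nearly equal.\<close>

lemma residue_prob_mod_3_half:
  "real_of_int \<lfloor>2 ^ N / 3 :: real\<rfloor> / 2 ^ N \<le> residue_prob 3 N i j (1 / 2)"
proof -
  define p where "p = (\<lambda>i. residue_prob 3 N i j (1 / 2))"
  define c where "c = (\<lambda>i. \<Sum>t\<le>N. int (N choose t) * of_bool [t + i = j] (mod 3))"
  have pc: "2 ^ N * p i = real_of_int (c i)" for i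
  proof -
    have "2 ^ N * ((1 / 2 :: real) ^ t * (1 - 1 / 2) ^ (N - t)) = 1" if "t \<le> N" for t
      using that by (simp add: field_simps flip: power_add)
    hence "2 ^ N * (real (N choose t) * (1 / 2) ^ t * (1 - 1 / 2) ^ (N - t)
        * of_bool [t + i = j] (mod 3)) = real (N choose t) * of_bool [t + i = j] (mod 3)"
      if "t \<le> N" for t
      using that by (simp add: mult.left_commute mult.assoc del: diff_numeral_special)
    thus ?thesis
      unfolding p_def c_def residue_prob_def binomial_mean_def sum_distrib_left of_int_sum
      by (intro sum.cong) simp_all
  qed
  have s: "c i + c (i + 1) + c (i + 2) = 2 ^ N"
  proof -
    have "real_of_int (c i + c (i + 1) + c (i + 2)) = 2 ^ N * (p i + p (i + 1) + p (i + 2))"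
      by (simp add: pc algebra_simps flip: pc)
    thus ?thesis
      using residue_prob_mod_3(1) [of N i j "1 / 2"] unfolding p_def
      by (metis mult.right_neutral of_int_eq_iff of_int_numeral of_int_power)
  qed
  have q: "(c i - c (i + 1))\<^sup>2 + (c (i + 1) - c (i + 2))\<^sup>2 + (c (i + 2) - c i)\<^sup>2 = 2"
  proof -
    have "real_of_int ((c i - c (i + 1))\<^sup>2 + (c (i + 1) - c (i + 2))\<^sup>2 + (c (i + 2) - c i)\<^sup>2)
      = (2 ^ N)\<^sup>2 * ((p i - p (i + 1))\<^sup>2 + (p (i + 1) - p (i + 2))\<^sup>2 + (p (i + 2) - p i)\<^sup>2)"
      by (simp add: power2_eq_square algebra_simps flip: pc)
    also have "\<dots> = (2 ^ N)\<^sup>2 * (2 * (1 / 4) ^ N)"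
      using residue_prob_mod_3(2) [of N i j "1 / 2"] unfolding p_def
      by (simp add: power2_eq_square)
    also have "(2 ^ N)\<^sup>2 = (4 :: real) ^ N"
      by (simp add: power2_eq_square flip: power_mult_distrib)
    also have "4 ^ N * (2 * (1 / 4) ^ N) = (2 :: real)"
      by (simp add: power_one_over)
    finally show ?thesis by linarith
  qed
  have small: "\<bar>z\<bar> \<le> 1" if "z\<^sup>2 \<le> 2" for z :: int
  proof (rule ccontr)
    assume "\<not> \<bar>z\<bar> \<le> 1"
    hence "2\<^sup>2 \<le> \<bar>z\<bar>\<^sup>2" by (intro power_mono) auto
    with that show False by simp
  qed
  have "\<bar>c i - c (i + 1)\<bar> \<le> 1" "\<bar>c (i + 2) - c i\<bar> \<le> 1"
    using q zero_le_power2 [of "c i - c (i + 1)"] zero_le_power2 [of "c (i + 1) - c (i + 2)"]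
      zero_le_power2 [of "c (i + 2) - c i"] by (intro small; linarith)+
  \<comment> \<open>The other two counts are at most \<open>c i + 1\<close> each. Since
    \<open>3 * c i + 2 < 3 * (c i + 1)\<close>, the floor of \<open>2 ^ N / 3\<close> cannot exceed
    \<open>c i\<close>.\<close>
  hence "(2 ^ N :: int) \<le> 3 * c i + 2" using s by linarith
  hence "(2 ^ N :: real) \<le> 3 * real_of_int (c i) + 2"
    by (metis (mono_tags, lifting) of_int_le_iff of_int_add of_int_mult of_int_numeral of_int_power)
  hence "\<lfloor>2 ^ N / 3 :: real\<rfloor> \<le> c i"
    by (simp add: floor_le_iff)
  hence "real_of_int \<lfloor>2 ^ N / 3 :: real\<rfloor> \<le> 2 ^ N * p i"
    by (simp add: pc)
  thus ?thesis by (simp add: p_def field_simps)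
qed

section \<open>Degrees in the partition construction\<close>

text \<open>A subset of the disjoint union is the same as a pair of subsets of \<open>A\<close> and
  \<open>B\<close>. The sets are grouped into classes \<open>F t\<close> by the size
  \<open>t\<close> of their part in \<open>A\<close>.\<close>

lemma card_split_subsets:
  assumes "finite A" "finite B" "A \<inter> B = {}"
  shows "card {T. T \<subseteq> A \<union> B \<and> card T = N \<and> P (card (T \<inter> A))}
       = (\<Sum>t\<le>N. (card A choose t) * (card B choose (N - t)) * of_bool (P t))"
proof -
  define F where "F = (\<lambda>t. (\<lambda>(X, Y). X \<union> Y) `
    ({X. X \<subseteq> A \<and> card X = t} \<times> {Y. Y \<subseteq> B \<and> card Y = N - t}))"
  have inA: "(X \<union> Y) \<inter> A = X" if "X \<subseteq> A" "Y \<subseteq> B" for X Y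
    using that assms(3) by blast
  have inB: "(X \<union> Y) \<inter> B = Y" if "X \<subseteq> A" "Y \<subseteq> B" for X Y
    using that assms(3) by blast
  have eq: "{T. T \<subseteq> A \<union> B \<and> card T = N \<and> P (card (T \<inter> A))} = (\<Union>t\<in>{t. t \<le> N \<and> P t}. F t)"
    (is "?L = ?R")
  proof (intro Set.set_eqI iffI)
    fix T assume "T \<in> ?L"
    hence T: "T \<subseteq> A \<union> B" "card T = N" "P (card (T \<inter> A))" by auto
    have "card T = card (T \<inter> A) + card (T \<inter> B)"
    proof -
      have "T = (T \<inter> A) \<union> (T \<inter> B)" using T by blast
      moreover have "card ((T \<inter> A) \<union> (T \<inter> B)) = card (T \<inter> A) + card (T \<inter> B)"
        using assms by (intro card_Un_disjoint) auto
      ultimately show ?thesis by simp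
    qed
    hence "card (T \<inter> A) \<le> N" "card (T \<inter> B) = N - card (T \<inter> A)" using T(2) by simp_all
    moreover from this have "T \<in> F (card (T \<inter> A))"
      unfolding F_def using T(1) by (intro image_eqI [where x = "(T \<inter> A, T \<inter> B)"]) auto
    ultimately show "T \<in> ?R" using T(3) by blast
  next
    fix T assume "T \<in> ?R"
    then obtain t X Y where *: "t \<le> N" "P t" "T = X \<union> Y" "X \<subseteq> A" "Y \<subseteq> B"
      "card X = t" "card Y = N - t" by (auto simp: F_def)
    have "card (X \<union> Y) = card X + card Y"
      using *(4,5) assms by (intro card_Un_disjoint) (auto intro: finite_subset)
    thus "T \<in> ?L" using * inA [of X Y] by auto
  qed
  have cF: "card (F t) = (card A choose t) * (card B choose (N - t))" for t
  proof -
    have "inj_on (\<lambda>(X, Y). X \<union> Y) ({X. X \<subseteq> A \<and> card X = t} \<times> {Y. Y \<subseteq> B \<and> card Y = N - t})"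
      by (rule inj_on_inverseI [where g = "\<lambda>T. (T \<inter> A, T \<inter> B)"]) (use assms(3) in auto)
    thus ?thesis
      using assms by (simp add: F_def card_image card_cartesian_product n_subsets)
  qed
  have fin: "finite (F t)" for t
    unfolding F_def using assms by auto
  have disj: "F s \<inter> F t = {}" if "s \<noteq> t" for s t
  proof -
    have "card (T \<inter> A) = t" if "T \<in> F t" for T t
      using that by (auto simp: F_def inA)
    thus ?thesis using that by blast
  qed
  have "card {T. T \<subseteq> A \<union> B \<and> card T = N \<and> P (card (T \<inter> A))}
      = (\<Sum>t\<in>{t. t \<le> N \<and> P t}. card (F t))"
    unfolding eq using fin disj by (intro card_UN_disjoint) auto
  also have "\<dots> = (\<Sum>t\<le>N. (card A choose t) * (card B choose (N - t)) * of_bool (P t))"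
    unfolding cF by (intro sum.mono_neutral_cong_left) auto
  finally show ?thesis .
qed

text \<open>The degree of a \<open>d\<close>-set with \<open>i\<close> vertices in the first part, for \<open>n\<close> vertices, a first part
  of size \<open>a\<close>, \<open>m = l + 2\<close> and \<open>N = k - d\<close>. It is meaningful only for \<open>i \<le> a\<close> and
  \<open>d - i \<le> n - a\<close>; otherwise the subtractions truncate.\<close>

definition split_degree :: "nat \<Rightarrow> nat \<Rightarrow> nat \<Rightarrow> nat \<Rightarrow> nat \<Rightarrow> nat \<Rightarrow> nat \<Rightarrow> nat" where
  "split_degree m d N n a i j = (\<Sum>t\<le>N. ((a - i) choose t) * ((n - a - (d - i)) choose (N - t))
       * of_bool [t + i = j] (mod m))"

text \<open>Deleting \<open>S\<close> is a bijection from the edges containing \<open>S\<close> to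
  the \<open>N\<close>-sets outside \<open>S\<close> whose intersection with the first part,
  increased by \<open>i\<close>, has residue \<open>j\<close>. Writing the uniformity as
  \<open>d + N\<close> avoids a truncated subtraction.\<close>

lemma degree_part_edges:
  assumes "finite V" "V1 \<subseteq> V" "S \<subseteq> V" "card S = d"
  shows "degree (part_edges (d + N) l j V V1) S
       = split_degree (l + 2) d N (card V) (card V1) (card (S \<inter> V1)) j"
proof -
  define i where "i = card (S \<inter> V1)"
  have fS: "finite S" "finite V1" using assms finite_subset by auto
  have dS: "d = i + card (S - V1)"
    unfolding i_def using assms(4) card_Diff_subset_Int[of S V1] fS card_mono[of S "S \<inter> V1"] by simp
  define A where "A = V1 - S"
  define B where "B = V - V1 - S"
  have cA: "card A = card V1 - i"
    using fS by (simp add: A_def i_def card_Diff_subset_Int Int_commute)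
  have cB: "card B = card V - card V1 - (d - i)"
  proof -
    have "(V - V1) \<inter> S = S - V1" using assms by auto
    hence "card B = card (V - V1) - card (S - V1)"
      using fS by (simp add: B_def card_Diff_subset_Int)
    thus ?thesis
      using assms fS dS by (simp add: card_Diff_subset)
  qed
  have "bij_betw (\<lambda>e. e - S) {e \<in> part_edges (d + N) l j V V1. S \<subseteq> e}
    {T. T \<subseteq> A \<union> B \<and> card T = N \<and> [card (T \<inter> A) + i = j] (mod (l + 2))}"
  proof (rule bij_betwI [where g = "\<lambda>T. T \<union> S"])
    have *: "card ((T \<union> S) \<inter> V1) = card (T \<inter> A) + i" "card (T \<union> S) = card T + d"
      if "T \<subseteq> A \<union> B" for T
    proof -
      have "finite T" "T \<inter> S = {}"
        using that assms by (auto simp: A_def B_def intro: finite_subset)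
      thus "card (T \<union> S) = card T + d" using fS assms by (simp add: card_Un_disjoint)
      have "(T \<union> S) \<inter> V1 = (T \<inter> A) \<union> (S \<inter> V1)" using that by (auto simp: A_def B_def)
      moreover have "card ((T \<inter> A) \<union> (S \<inter> V1)) = card (T \<inter> A) + card (S \<inter> V1)"
        using \<open>finite T\<close> fS by (intro card_Un_disjoint) (auto simp: A_def)
      ultimately show "card ((T \<union> S) \<inter> V1) = card (T \<inter> A) + i" by (simp add: i_def)
    qed
    show "(\<lambda>T. T \<union> S) \<in> {T. T \<subseteq> A \<union> B \<and> card T = N \<and> [card (T \<inter> A) + i = j] (mod (l + 2))}
        \<rightarrow> {e \<in> part_edges (d + N) l j V V1. S \<subseteq> e}"
    proof (intro funcsetI)
      fix T assume "T \<in> {T. T \<subseteq> A \<union> B \<and> card T = N \<and> [card (T \<inter> A) + i = j] (mod (l + 2))}"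
      hence T: "T \<subseteq> A \<union> B" "card T = N" "[card (T \<inter> A) + i = j] (mod (l + 2))" by blast+
      moreover have "T \<union> S \<subseteq> V" using T(1) assms(2,3) unfolding A_def B_def by blast
      ultimately show "T \<union> S \<in> {e \<in> part_edges (d + N) l j V V1. S \<subseteq> e}"
        by (simp add: part_edges_def * [OF T(1)] add.commute)
    qed
    show "(\<lambda>e. e - S) \<in> {e \<in> part_edges (d + N) l j V V1. S \<subseteq> e}
        \<rightarrow> {T. T \<subseteq> A \<union> B \<and> card T = N \<and> [card (T \<inter> A) + i = j] (mod (l + 2))}"
    proof (intro funcsetI)
      fix e assume "e \<in> {e \<in> part_edges (d + N) l j V V1. S \<subseteq> e}"
      hence e: "e \<subseteq> V" "card e = d + N" "[card (e \<inter> V1) = j] (mod (l + 2))" "S \<subseteq> e"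
        by (auto simp: part_edges_def)
      have "e - S \<subseteq> A \<union> B" "(e - S) \<union> S = e" using e assms by (auto simp: A_def B_def)
      thus "e - S \<in> {T. T \<subseteq> A \<union> B \<and> card T = N \<and> [card (T \<inter> A) + i = j] (mod (l + 2))}"
        using * [of "e - S"] e by simp
    qed
    fix T assume "T \<in> {T. T \<subseteq> A \<union> B \<and> card T = N \<and> [card (T \<inter> A) + i = j] (mod (l + 2))}"
    thus "T \<union> S - S = T" by (auto simp: A_def B_def)
  qed auto
  hence "degree (part_edges (d + N) l j V V1) S
    = card {T. T \<subseteq> A \<union> B \<and> card T = N \<and> [card (T \<inter> A) + i = j] (mod (l + 2))}"
    unfolding degree_def by (rule bij_betw_same_card)
  also have "\<dots> = split_degree (l + 2) d N (card V) (card V1) i j"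
    unfolding split_degree_def cA [symmetric] cB [symmetric]
    using assms fS by (intro card_split_subsets) (auto simp: A_def B_def)
  finally show ?thesis by (simp add: i_def)
qed

text \<open>The conditions on \<open>i\<close> say that some \<open>d\<close>-set has exactly
  \<open>i\<close> vertices in the first part; any such set bounds the minimum from above.\<close>

lemma min_degree_le_split_degree:
  assumes "a \<le> n" "i \<le> d" "i \<le> a" "d - i \<le> n - a"
  shows "min_degree d {..<n} (part_edges (d + N) l j {..<n} {..<a})
       \<le> split_degree (l + 2) d N n a i j"
proof -
  \<comment> \<open>The first \<open>i\<close> vertices of the first part and the first
    \<open>d - i\<close> of the second.\<close>
  let ?S = "{..<i} \<union> {a..<a + (d - i)}"
  have S: "?S \<subseteq> {..<n}" "?S \<inter> {..<a} = {..<i}" using assms by auto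
  have "card ?S = d" using assms by (subst card_Un_disjoint) auto
  hence "min_degree d {..<n} (part_edges (d + N) l j {..<n} {..<a})
    \<le> degree (part_edges (d + N) l j {..<n} {..<a}) ?S"
    unfolding min_degree_def using S by (intro Min_le) auto
  thus ?thesis
    using degree_part_edges [of "{..<n}" "{..<a}" ?S d N l j] S assms \<open>card ?S = d\<close> by simp
qed

text \<open>The minimum is attained by some \<open>S\<close>; take for \<open>i\<close> the number
  of its vertices in the first part.\<close>

lemma min_degree_ge_split_degree:
  assumes "a \<le> n" "d \<le> n"
  shows "\<exists>i\<le>d. split_degree (l + 2) d N n a i j
    \<le> min_degree d {..<n} (part_edges (d + N) l j {..<n} {..<a})"
proof -
  let ?D = "{S. S \<subseteq> {..<n} \<and> card S = d}"
  let ?E = "part_edges (d + N) l j {..<n} {..<a}"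
  have "{..<d} \<in> ?D" using assms by auto
  hence "min_degree d {..<n} ?E \<in> degree ?E ` ?D"
    unfolding min_degree_def by (intro Min_in finite_imageI) (simp, blast)
  then obtain S where S: "S \<subseteq> {..<n}" "card S = d" "min_degree d {..<n} ?E = degree ?E S"
    by auto
  have "card (S \<inter> {..<a}) \<le> d"
    using S by (metis Int_lower1 card_mono finite_lessThan finite_subset)
  thus ?thesis
    using degree_part_edges [of "{..<n}" "{..<a}" S d N l j] S assms by auto
qed

section \<open>Asymptotics of the degrees\<close>

lemma uniform_limit_of_dist_le:
  fixes f :: "nat \<Rightarrow> 'a \<Rightarrow> real"
  assumes "\<And>n x. n > 0 \<Longrightarrow> x \<in> A \<Longrightarrow> \<bar>f n x - h x\<bar> \<le> c / real n"
  shows "uniform_limit A f h sequentially"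
proof (rule uniform_limitI)
  fix e :: real assume "e > 0"
  have "(\<lambda>n. c / real n) \<longlonglongrightarrow> 0"
    by (rule lim_const_over_n)
  hence "\<forall>\<^sub>F n in sequentially. c / real n < e"
    using \<open>e > 0\<close> by (rule order_tendstoD)
  moreover have "\<forall>\<^sub>F n in sequentially. 0 < n" by (rule eventually_gt_at_top)
  ultimately show "\<forall>\<^sub>F n in sequentially. \<forall>x\<in>A. dist (f n x) (h x) < e"
  proof eventually_elim
    case (elim n)
    thus ?case unfolding dist_real_def using assms [of n] le_less_trans by blast
  qed
qed

text \<open>Induction on \<open>t\<close> through
  \<open>(t + 1) * (M choose (t + 1)) = (M - t) * (M choose t)\<close>, with one factor
  \<open>n\<close> divided out each time. Boundedness of the limits is what allows uniform limits to
  be multiplied.\<close>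

lemma uniform_limit_binomial_over_power:
  fixes y :: "'a \<Rightarrow> real"
  assumes "uniform_limit A (\<lambda>n x. real (m n x) / real n) y sequentially"
    and "bounded (y ` A)"
  shows "uniform_limit A (\<lambda>n x. real (m n x choose t) / real n ^ t) (\<lambda>x. y x ^ t / fact t) sequentially"
proof (induction t)
  case 0
  show ?case by (simp add: uniform_limit_const)
next
  case (Suc t)
  have b: "bounded ((\<lambda>x. y x ^ t / fact t) ` A)" for t
  proof -
    from assms(2) obtain b where "\<And>x. x \<in> A \<Longrightarrow> \<bar>y x\<bar> \<le> b"
      by (auto simp: bounded_iff)
    hence "\<bar>y x ^ t / fact t\<bar> \<le> b ^ t / fact t" if "x \<in> A" for x
      using that by (auto simp: power_abs power_mono divide_right_mono)
    thus ?thesis by (auto simp: bounded_iff)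
  qed
  have "uniform_limit A (\<lambda>n x. real t / real n) (\<lambda>_. 0) sequentially"
    by (rule uniform_limit_of_dist_le [where c = "real t"]) simp
  from uniform_limit_minus [OF assms(1) this]
  have l: "uniform_limit A (\<lambda>n x. real (m n x) / real n - real t / real n) y sequentially"
    by simp
  have lim: "uniform_limit A (\<lambda>n x. (1 / real (Suc t)) * (real (m n x choose t) / real n ^ t *
      (real (m n x) / real n - real t / real n)))
      (\<lambda>x. (1 / real (Suc t)) * (y x ^ t / fact t * y x)) sequentially"
    by (rule bounded_linear.uniform_limit [OF bounded_linear_mult_right])
       (rule uniform_lim_mult [OF Suc.IH l b assms(2)])
  have y: "(1 / real (Suc t)) * (y x ^ t / fact t * y x) = y x ^ Suc t / fact (Suc t)" for x
    by (auto simp: field_simps)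
  have m: "(1 / real (Suc t)) * (real (m n x choose t) / real n ^ t *
      (real (m n x) / real n - real t / real n)) = real (m n x choose Suc t) / real n ^ Suc t" for n x
  proof -
    \<comment> \<open>The subtraction on the right is real; for \<open>m n x < t\<close> both
      binomial coefficients are 0.\<close>
    have "real (Suc t) * real (m n x choose Suc t) = real (m n x choose t) * (real (m n x) - real t)"
    proof (cases "t \<le> m n x")
      case True
      have "Suc t * (m n x choose Suc t) = (m n x - t) * (m n x choose t)"
        using binomial_absorb_comp [of "m n x" t] binomial_absorption [of t "m n x"]
        by (metis mult.commute)
      hence "real (Suc t * (m n x choose Suc t)) = real ((m n x - t) * (m n x choose t))"
        by simp
      thus ?thesis using True by (simp only: of_nat_mult of_nat_diff mult.commute)
    qed (simp add: binomial_eq_0)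
    hence "real (m n x choose Suc t) = real (m n x choose t) * (real (m n x) - real t) / real (Suc t)"
      by (simp add: field_simps)
    thus ?thesis by (simp add: diff_divide_distrib[symmetric])
  qed
  show ?case using lim unfolding y m .
qed

lemma uniform_limit_sum:
  fixes f :: "'i \<Rightarrow> 'n \<Rightarrow> 'a \<Rightarrow> 'b :: real_normed_vector"
  assumes "\<And>i. i \<in> I \<Longrightarrow> uniform_limit A (f i) (h i) F"
  shows "uniform_limit A (\<lambda>n x. \<Sum>i\<in>I. f i n x) (\<lambda>x. \<Sum>i\<in>I. h i x) F"
  using assms
  by (induction I rule: infinite_finite_induct) (auto intro!: uniform_limit_intros)

lemma bounded_power_unit_interval:
  "bounded ((\<lambda>x::real. x ^ t / fact t) ` {0..1})" "bounded ((\<lambda>x::real. (1 - x) ^ t / fact t) ` {0..1})"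
  by (intro compact_imp_bounded compact_continuous_image continuous_intros; simp)+

text \<open>Each summand has order \<open>n ^ N\<close> and the normalising binomial is asymptotic
  to \<open>n ^ N / fact N\<close>, so the quotient tends to a binomial weight; the bounded shifts
  by \<open>i\<close> and \<open>d - i\<close> disappear. Uniformity matters because the admissible
  \<open>x\<close> vary with \<open>n\<close>.\<close>

lemma uniform_limit_split_degree:
  "uniform_limit {0..1}
     (\<lambda>n x. real (split_degree m d N n (nat \<lfloor>x * real n\<rfloor>) i j) / real ((n - d) choose N))
     (residue_prob m N i j) sequentially"
proof -
  define a where "a = (\<lambda>n x. nat \<lfloor>x * real n\<rfloor>)"
  have a: "real (a n x) \<le> x * real n" "x * real n \<le> real (a n x) + 1" "a n x \<le> n"
    if "x \<in> {0..1}" for n x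
  proof -
    have "0 \<le> x * real n" using that by simp
    thus 1: "real (a n x) \<le> x * real n" "x * real n \<le> real (a n x) + 1"
      unfolding a_def by linarith+
    have "x * real n \<le> real n" using that by (simp add: mult_left_le_one_le)
    thus "a n x \<le> n" using 1 by linarith
  qed
  \<comment> \<open>With truncation written as a maximum, the linear error bounds below also cover
    small parts. The extra 1 in their constants pays for rounding \<open>x * real n\<close>
    down.\<close>
  have diff: "real (p - q) = max 0 (real p - real q)" for p q :: nat
    by (cases "q \<le> p") (simp_all add: of_nat_diff)
  have close: "\<bar>real M / real n - z\<bar> \<le> c / real n"
    if "n > 0" "\<bar>real M - z * real n\<bar> \<le> c" for M n z c
  proof -
    have "real M / real n - z = (real M - z * real n) / real n"
      using that by (simp add: field_simps)
    thus ?thesis using that by (simp add: divide_right_mono)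
  qed
  have "uniform_limit {0..1} (\<lambda>n x. real (a n x - i) / real n) (\<lambda>x. x) sequentially"
  proof (rule uniform_limit_of_dist_le [where c = "real i + 1"], rule close)
    fix n x assume "x \<in> {0..1::real}"
    thus "\<bar>real (a n x - i) - x * real n\<bar> \<le> real i + 1"
      using a [of x n] by (auto simp: diff)
  qed
  from uniform_limit_binomial_over_power [OF this]
  have 1: "uniform_limit {0..1} (\<lambda>n x. real (a n x - i choose t) / real n ^ t)
      (\<lambda>x. x ^ t / fact t) sequentially" for t
    using bounded_power_unit_interval(1) [of 1] by simp
  have "uniform_limit {0..1} (\<lambda>n x. real (n - a n x - (d - i)) / real n) (\<lambda>x. 1 - x) sequentially"
  proof (rule uniform_limit_of_dist_le [where c = "real d + 1"], rule close)
    fix n x assume "x \<in> {0..1::real}"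
    thus "\<bar>real (n - a n x - (d - i)) - (1 - x) * real n\<bar> \<le> real d + 1"
      using a [of x n] by (auto simp: diff algebra_simps)
  qed
  from uniform_limit_binomial_over_power [OF this]
  have 2: "uniform_limit {0..1} (\<lambda>n x. real (n - a n x - (d - i) choose t) / real n ^ t)
      (\<lambda>x. (1 - x) ^ t / fact t) sequentially" for t
    using bounded_power_unit_interval(2) [of 1] by simp
  have "uniform_limit {0..1::real} (\<lambda>n x. real (n - d) / real n) (\<lambda>_. 1) sequentially"
    by (rule uniform_limit_of_dist_le [where c = "real d"], rule close) (auto simp: diff)
  from uniform_limit_binomial_over_power [OF this]
  have 3: "uniform_limit {0..1::real} (\<lambda>n x. real (n - d choose N) / real n ^ N)
      (\<lambda>_. 1 / fact N) sequentially"
    by (simp add: image_constant_conv)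
  have "uniform_limit {0..1} (\<lambda>n x. \<Sum>t\<le>N. of_bool [t + i = j] (mod m) *
       (real (a n x - i choose t) / real n ^ t * (real (n - a n x - (d - i) choose (N - t)) / real n ^ (N - t))))
     (\<lambda>x. \<Sum>t\<le>N. of_bool [t + i = j] (mod m) * (x ^ t / fact t * ((1 - x) ^ (N - t) / fact (N - t))))
     sequentially"
    by (intro uniform_limit_sum bounded_linear.uniform_limit [OF bounded_linear_mult_right]
          uniform_lim_mult 1 2 bounded_power_unit_interval)
  also have "(\<lambda>n x. \<Sum>t\<le>N. of_bool [t + i = j] (mod m) *
       (real (a n x - i choose t) / real n ^ t * (real (n - a n x - (d - i) choose (N - t)) / real n ^ (N - t))))
     = (\<lambda>n x. real (split_degree m d N n (a n x) i j) / real n ^ N)"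
    unfolding split_degree_def of_nat_sum sum_divide_distrib
    by (intro ext sum.cong) (auto simp flip: power_add)
  finally have lim: "uniform_limit {0..1} (\<lambda>n x. real (split_degree m d N n (a n x) i j) / real n ^ N)
     (\<lambda>x. \<Sum>t\<le>N. of_bool [t + i = j] (mod m) * (x ^ t / fact t * ((1 - x) ^ (N - t) / fact (N - t))))
     sequentially" .
  have bd: "bounded ((\<lambda>x. \<Sum>t\<le>N. of_bool [t + i = j] (mod m) *
      (x ^ t / fact t * ((1 - x) ^ (N - t) / fact (N - t)))) ` {0..1::real})"
    by (intro compact_imp_bounded compact_continuous_image continuous_intros) auto
  have "uniform_limit {0..1} (\<lambda>n x. real (split_degree m d N n (a n x) i j) / real n ^ N
      / (real (n - d choose N) / real n ^ N))
     (\<lambda>x. (\<Sum>t\<le>N. of_bool [t + i = j] (mod m) * (x ^ t / fact t * ((1 - x) ^ (N - t) / fact (N - t))))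
       / (1 / fact N))
     sequentially" (is "uniform_limit _ ?f ?g _")
    by (rule uniform_lim_divide [OF lim 3 bd, where b = "1 / fact N"]) simp_all
  also have "?g = residue_prob m N i j"
    unfolding residue_prob_def binomial_mean_def sum_divide_distrib
  proof (intro ext sum.cong)
    fix x :: real and t assume "t \<in> {..N}"
    hence "real (N choose t) = fact N / (fact t * fact (N - t))"
      by (simp add: binomial_fact)
    thus "of_bool [t + i = j] (mod m) * (x ^ t / fact t * ((1 - x) ^ (N - t) / fact (N - t)))
        / (1 / fact N) = real (N choose t) * x ^ t * (1 - x) ^ (N - t) * of_bool [t + i = j] (mod m)"
      by (simp only:) simp
  qed simp
  also have "uniform_limit {0..1} ?f (residue_prob m N i j) sequentially \<longleftrightarrow>
     uniform_limit {0..1} (\<lambda>n x. real (split_degree m d N n (a n x) i j) / real (n - d choose N))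
       (residue_prob m N i j) sequentially"
    \<comment> \<open>The powers of \<open>n\<close> are cancelled for \<open>n > 0\<close>, which
      holds eventually.\<close>
    by (rule uniform_limit_cong) (auto intro: eventually_mono [OF eventually_gt_at_top [of 0]])
  finally show ?thesis by (simp add: a_def)
qed

section \<open>The limit \<open>g\<close>\<close>

lemma continuous_on_Min:
  fixes f :: "'i \<Rightarrow> 'a :: topological_space \<Rightarrow> 'b :: linorder_topology"
  assumes "finite I" "I \<noteq> {}" "\<And>i. i \<in> I \<Longrightarrow> continuous_on A (f i)"
  shows "continuous_on A (\<lambda>x. Min ((\<lambda>i. f i x) ` I))"
  using assms
  by (induction I rule: finite_ne_induct) (auto intro!: continuous_on_min)

text \<open>The minimum over \<open>i\<close> is continuous in \<open>x\<close>, hence attains its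
  maximum on the compact interval for each of the finitely many \<open>j\<close>. The value
  \<open>G\<close> is described by a witness and by inequalities, the form in which the limit
  argument uses it.\<close>

lemma exists_max_min:
  fixes p :: "nat \<Rightarrow> nat \<Rightarrow> real \<Rightarrow> real"
  assumes "\<And>i j. continuous_on {0..1} (p i j)"
  shows "\<exists>G. \<exists>j0\<le>J. \<exists>x0\<in>{0..1}. (\<forall>i\<le>d. G \<le> p i j0 x0)
    \<and> (\<forall>j\<le>J. \<forall>x\<in>{0..1}. \<exists>i\<le>d. p i j x \<le> G)"
proof -
  define F where "F = (\<lambda>j x. Min ((\<lambda>i. p i j x) ` {..d}))"
  have "\<exists>y\<in>{0..1}. \<forall>x\<in>{0..1}. F j x \<le> F j y" for j
    unfolding F_def by (intro continuous_attains_sup continuous_on_Min assms) auto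
  then obtain y where y: "\<And>j. y j \<in> {0..1}" "\<And>j x. x \<in> {0..1} \<Longrightarrow> F j x \<le> F j (y j)"
    by metis
  have "Max ((\<lambda>j. F j (y j)) ` {..J}) \<in> (\<lambda>j. F j (y j)) ` {..J}"
    by (intro Max_in) auto
  then obtain j0 where j0: "j0 \<in> {..J}" "Max ((\<lambda>j. F j (y j)) ` {..J}) = F j0 (y j0)"
    by blast
  have "F j (y j) \<le> F j0 (y j0)" if "j \<le> J" for j
    unfolding j0(2) [symmetric] using that by (intro Max_ge) auto
  hence le: "F j x \<le> F j0 (y j0)" if "j \<le> J" "x \<in> {0..1}" for j x
    using order_trans [OF y(2) [OF that(2)]] that(1) by blast
  have "F j x \<in> (\<lambda>i. p i j x) ` {..d}" for j x
    unfolding F_def by (intro Min_in) auto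
  hence "\<exists>i\<le>d. F j x = p i j x" for j x
    by auto
  hence "\<forall>j\<le>J. \<forall>x\<in>{0..1}. \<exists>i\<le>d. p i j x \<le> F j0 (y j0)"
    using le by metis
  moreover have "\<forall>i\<le>d. F j0 (y j0) \<le> p i j0 (y j0)"
    by (simp add: F_def)
  ultimately show ?thesis using j0(1) y(1) by blast
qed

section \<open>Admissible sizes of the first part\<close>

lemma finite_admissible:
  assumes "n > 0"
  shows "finite (admissible k l j n)"
proof (rule finite_subset)
  show "admissible k l j n \<subseteq> (\<lambda>a. real a / real n) ` {..n}"
  proof
    fix x assume "x \<in> admissible k l j n"
    then obtain a :: nat where x: "0 \<le> x" "x \<le> 1" "x * real n = real a"
      by (auto simp: admissible_def)
    have "x * real n \<le> 1 * real n" using x by (intro mult_right_mono) auto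
    hence "a \<le> n" using x by simp
    moreover have "x = real a / real n" using x assms by (simp add: field_simps)
    ultimately show "x \<in> (\<lambda>a. real a / real n) ` {..n}" by auto
  qed
qed simp

text \<open>Admissible sizes fill a residue class modulo \<open>l + 2\<close>, so every window of
  \<open>l + 2\<close> consecutive integers inside the range contains one.\<close>

lemma admissible_near:
  assumes "l + 1 \<le> n" "y \<in> {0..1}"
  shows "\<exists>x\<in>admissible k l j n. \<bar>x - y\<bar> \<le> real (l + 2) / real n"
proof -
  have n: "real n > 0" using assms by simp
  define a0 where "a0 = nat \<lfloor>y * real n\<rfloor>"
  have "0 \<le> y * real n" "y * real n \<le> real n"
    using assms by (auto simp: mult_left_le_one_le)
  hence a0: "real a0 \<le> y * real n" "y * real n \<le> real a0 + 1" "a0 \<le> n"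
    unfolding a0_def by linarith+
  \<comment> \<open>The window starts at \<open>b\<close>, truncated at 0, so that
    \<open>b + c\<close> with \<open>c \<le> l + 1\<close> stays below \<open>n\<close>.\<close>
  define b where "b = a0 - (l + 1)"
  define v where "v = (n div k) * j + l + 1"
  \<comment> \<open>Since \<open>l + 1\<close> is -1 modulo \<open>l + 2\<close>, this is the
    residue of \<open>v - b\<close> without subtraction of naturals.\<close>
  define c where "c = (v + (l + 1) * b) mod (l + 2)"
  define a where "a = b + c"
  have "[a = b + (v + (l + 1) * b)] (mod (l + 2))"
    unfolding a_def c_def by (simp add: cong_def mod_simps)
  also have "b + (v + (l + 1) * b) = v + (l + 2) * b"
    by (simp add: algebra_simps)
  also have "[v + (l + 2) * b = v] (mod (l + 2))"
    unfolding cong_def by (simp only: mod_mult_self2)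
  finally have "[a = v] (mod (l + 2))" .
  have "c < l + 2" unfolding c_def by simp
  hence a: "a \<le> n" "\<bar>real a - real a0\<bar> \<le> real (l + 1)"
    using a0(3) assms(1) unfolding a_def b_def by linarith+
  have "real a / real n \<in> admissible k l j n"
    using \<open>[a = v] (mod (l + 2))\<close> a n unfolding admissible_def v_def by auto
  moreover have "\<bar>real a / real n - y\<bar> \<le> real (l + 2) / real n"
  proof -
    have "real a / real n - y = (real a - y * real n) / real n"
      using n by (simp add: field_simps)
    moreover have "\<bar>real a - y * real n\<bar> \<le> real (l + 2)"
      using a a0 by simp
    ultimately show ?thesis using n by (simp add: divide_right_mono)
  qed
  ultimately show ?thesis by blast
qed

text \<open>The divisibility barrier: the congruence on \<open>x * n\<close> rules out the degenerate partitions
  in which every \<open>d\<close>-set has full degree, so that also at \<open>x = 0\<close> and \<open>x = 1\<close> some realisable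
  intersection size has limiting degree \<open>0\<close>.\<close>

lemma realisable_near_0:
  assumes "[a = (n div k) * j + l + 1] (mod (l + 2))" "j \<le> l + 1" "0 < d" "a < d" "2 * d \<le> n"
  shows "\<exists>i\<le>d. i \<le> a \<and> d - i \<le> n - a \<and> residue_prob (l + 2) N i j 0 = 0"
proof -
  \<comment> \<open>Otherwise the size condition would make 0 congruent to \<open>l + 1\<close>
    modulo \<open>l + 2\<close>.\<close>
  have "\<not> (a = 0 \<and> j = 0)"
  proof
    assume "a = 0 \<and> j = 0"
    with assms(1) show False by (simp add: cong_def)
  qed
  moreover have "[i = j] (mod (l + 2)) \<longleftrightarrow> i = j" if "i \<le> 1" for i
  proof -
    have "i < l + 2" "j < l + 2" using assms(2) that by linarith+
    thus ?thesis by (simp only: cong_def mod_less)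
  qed
  \<comment> \<open>Take 0 if \<open>j\<close> is nonzero and 1 otherwise; in the latter case
    \<open>a\<close> is nonzero, so \<open>i \<le> a\<close>. At \<open>x = 0\<close> the binomial
    variable is constantly 0, and only \<open>i\<close> against \<open>j\<close> matters.\<close>
  moreover define i :: nat where "i = of_bool (j = 0)"
  ultimately have "i \<le> 1" "i \<le> a" "\<not> [i = j] (mod (l + 2))"
    by (cases "j = 0"; simp)+
  thus ?thesis
    using assms by (intro exI [of _ i]) (auto simp: residue_prob_def binomial_mean_at_0)
qed

text \<open>At \<open>x = 1\<close> the binomial variable is constantly \<open>N\<close>, so an
  \<open>i\<close> is sought with \<open>N + i\<close> not congruent to \<open>j\<close>. If
  \<open>a = n\<close>, take \<open>i = d\<close>: a congruence of \<open>k\<close> and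
  \<open>j\<close> would, by \<open>n = (n div k) * k + l\<close>, contradict the size condition. If
  \<open>a < n\<close>, then \<open>d - 1\<close> is realisable too, and consecutive integers cannot
  both be congruent to \<open>j\<close>.\<close>

lemma realisable_near_1:
  assumes "[a = (n div k) * j + l + 1] (mod (l + 2))" "[n = l] (mod k)" "l < k" "k = d + N"
    and "0 < d" "a \<le> n" "n - a < d" "2 * d \<le> n"
  shows "\<exists>i\<le>d. i \<le> a \<and> d - i \<le> n - a \<and> residue_prob (l + 2) N i j 1 = 0"
proof -
  have "\<not> [N + d = j] (mod (l + 2))" if "a = n"
  proof
    assume *: "[N + d = j] (mod (l + 2))"
    have "n mod k = l" using assms(2,3) by (simp add: cong_def)
    hence "n = (n div k) * k + l" by (metis div_mult_mod_eq)
    hence "[(n div k) * k + l = (n div k) * j + l + 1] (mod (l + 2))"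
      using assms(1) that by simp
    moreover have "[k = j] (mod (l + 2))"
      using * by (simp only: assms(4) add.commute)
    hence "[(n div k) * k + l = (n div k) * j + l] (mod (l + 2))"
      by (intro cong_add cong_mult cong_refl)
    ultimately have "[(n div k) * j + l + 0 = (n div k) * j + l + 1] (mod (l + 2))"
      unfolding add_0_right by (blast intro: cong_sym cong_trans)
    hence "[0 = 1] (mod (l + 2))" by (simp only: cong_add_lcancel_nat)
    thus False by (simp add: cong_def)
  qed
  moreover have "\<not> [N + d = j] (mod (l + 2)) \<or> \<not> [N + (d - 1) = j] (mod (l + 2))"
  proof (rule ccontr)
    assume "\<not> ?thesis"
    hence "[N + d = N + (d - 1)] (mod (l + 2))"
      by (blast intro: cong_sym cong_trans)
    moreover have "N + d = (N + (d - 1)) + 1" using assms(5) by simp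
    ultimately have "[(N + (d - 1)) + 1 = (N + (d - 1)) + 0] (mod (l + 2))"
      by (simp only: add_0_right)
    hence "[1 = 0] (mod (l + 2))" by (simp only: cong_add_lcancel_nat)
    thus False by (simp add: cong_def)
  qed
  ultimately obtain i where "i = d \<or> i = d - 1 \<and> a \<noteq> n" "\<not> [N + i = j] (mod (l + 2))"
    by blast
  thus ?thesis
    using assms by (intro exI [of _ i]) (auto simp: residue_prob_def binomial_mean_at_1)
qed

section \<open>Two-sided estimates and identification of the limit\<close>

text \<open>An index with limiting degree at most \<open>G\<close> can be unrealisable when a part
  has fewer than \<open>d\<close> vertices. Then \<open>x\<close> is within \<open>d / n\<close> of
  0 or 1, and the realisable index with limiting degree 0 there replaces it. One
  \<open>\<delta>\<close> pays for continuity and one for the approximation of degrees.\<close>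

lemma min_degree_H_le:
  assumes "1 \<le> d" "l < d + N" "[n = l] (mod (d + N))" "2 * d \<le> n" "d + N \<le> n" "j \<le> l + 1"
    and "x \<in> admissible (d + N) l j n"
    and G: "\<And>x. x \<in> {0..1} \<Longrightarrow> \<exists>i\<le>d. residue_prob (l + 2) N i j x \<le> G"
    and close: "\<And>i. i \<le> d \<Longrightarrow> \<bar>real (split_degree (l + 2) d N n (nat \<lfloor>x * real n\<rfloor>) i j)
        / real ((n - d) choose N) - residue_prob (l + 2) N i j x\<bar> < \<delta>"
    and cont: "\<And>i y. i \<le> d \<Longrightarrow> y \<in> {0..1} \<Longrightarrow> \<bar>x - y\<bar> \<le> real (d + l + 2) / real n \<Longrightarrow>
        \<bar>residue_prob (l + 2) N i j x - residue_prob (l + 2) N i j y\<bar> < \<delta>"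
  shows "real (min_degree d {..<n} (H_edges (d + N) l j n x))
     \<le> (G + 2 * \<delta>) * real ((n - d) choose N)"
proof -
  let ?B = "real ((n - d) choose N)"
  have n: "real n > 0" using assms by simp
  have B: "?B > 0" using assms by simp
  obtain a :: nat where x: "x \<in> {0..1}" "x * real n = real a"
    and a: "[a = (n div (d + N)) * j + l + 1] (mod (l + 2))"
    using assms(7) by (auto simp: admissible_def)
  have "x * real n \<le> 1 * real n" using x by (intro mult_right_mono) auto
  hence "a \<le> n" using x by simp
  have xa: "x = real a / real n" using x n by (simp add: field_simps)
  \<comment> \<open>Some probability is at most \<open>G\<close>, so \<open>G\<close> is
    nonnegative; this makes limiting degree 0 good enough in the two extreme cases.\<close>
  obtain i0 where "residue_prob (l + 2) N i0 j 0 \<le> G" using G [of 0] by auto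
  hence "0 \<le> G" using residue_prob_nonneg [of 0 "l + 2" N i0 j] by simp
  have "0 < \<delta>" using close [of 0] abs_ge_zero le_less_trans by blast
  have "\<exists>i\<le>d. i \<le> a \<and> d - i \<le> n - a \<and> residue_prob (l + 2) N i j x \<le> G + \<delta>"
  proof -
    consider "a < d" | "n - a < d" | "d \<le> a" "d \<le> n - a" by linarith
    thus ?thesis
    proof cases
      case 1
      then obtain i where i: "i \<le> d" "i \<le> a" "d - i \<le> n - a" "residue_prob (l + 2) N i j 0 = 0"
        using realisable_near_0 [OF a assms(6), of d N] assms(1,4) by auto
      have "\<bar>x - 0\<bar> \<le> real (d + l + 2) / real n"
        using 1 n by (simp add: xa divide_right_mono)
      hence "residue_prob (l + 2) N i j x < \<delta>" using cont [of i 0] i by simp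
      thus ?thesis using i \<open>0 \<le> G\<close> by (intro exI [of _ i]) simp
    next
      case 2
      then obtain i where i: "i \<le> d" "i \<le> a" "d - i \<le> n - a" "residue_prob (l + 2) N i j 1 = 0"
        using realisable_near_1 [OF a assms(3,2) refl _ \<open>a \<le> n\<close> 2 assms(4)] assms(1) by auto
      have "1 - x = real (n - a) / real n"
        using n \<open>a \<le> n\<close> by (simp add: xa of_nat_diff diff_divide_distrib)
      hence "\<bar>x - 1\<bar> = real (n - a) / real n"
        using x(1) by simp
      also have "\<dots> \<le> real (d + l + 2) / real n"
        using 2 n by (intro divide_right_mono) auto
      finally have "residue_prob (l + 2) N i j x < \<delta>" using cont [of i 1] i by simp
      thus ?thesis using i \<open>0 \<le> G\<close> by (intro exI [of _ i]) simp
    next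
      case 3
      obtain i where "i \<le> d" "residue_prob (l + 2) N i j x \<le> G" using G x by blast
      thus ?thesis using 3 \<open>0 < \<delta>\<close> by (intro exI [of _ i]) simp
    qed
  qed
  then obtain i where i: "i \<le> d" "i \<le> a" "d - i \<le> n - a" "residue_prob (l + 2) N i j x \<le> G + \<delta>"
    by blast
  have "nat \<lfloor>x * real n\<rfloor> = a" using x by simp
  hence "real (min_degree d {..<n} (H_edges (d + N) l j n x))
      \<le> real (split_degree (l + 2) d N n (nat \<lfloor>x * real n\<rfloor>) i j)"
    using min_degree_le_split_degree [OF \<open>a \<le> n\<close> i(1-3)] by (simp add: H_edges_def)
  moreover have "real (split_degree (l + 2) d N n (nat \<lfloor>x * real n\<rfloor>) i j) / ?B \<le> G + 2 * \<delta>"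
    using close [OF i(1)] i(4) by linarith
  ultimately show ?thesis using B by (simp add: divide_le_eq)
qed

text \<open>Here \<open>G\<close> bounds the limiting degrees at a nearby ideal point. One
  \<open>\<delta>\<close> allows for moving to the admissible \<open>x\<close>, the other for the
  approximation of degrees.\<close>

lemma min_degree_H_ge:
  assumes "d + N \<le> n" "x \<in> {0..1}"
    and close: "\<And>i. i \<le> d \<Longrightarrow> \<bar>real (split_degree (l + 2) d N n (nat \<lfloor>x * real n\<rfloor>) i j)
        / real ((n - d) choose N) - residue_prob (l + 2) N i j x\<bar> < \<delta>"
    and G: "\<And>i. i \<le> d \<Longrightarrow> G - \<delta> \<le> residue_prob (l + 2) N i j x"
  shows "(G - 2 * \<delta>) * real ((n - d) choose N)
     \<le> real (min_degree d {..<n} (H_edges (d + N) l j n x))"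
proof -
  have B: "real ((n - d) choose N) > 0" using assms by simp
  have "x * real n \<le> 1 * real n" using assms by (intro mult_right_mono) auto
  hence "nat \<lfloor>x * real n\<rfloor> \<le> n" by linarith
  then obtain i where i: "i \<le> d" "split_degree (l + 2) d N n (nat \<lfloor>x * real n\<rfloor>) i j
      \<le> min_degree d {..<n} (H_edges (d + N) l j n x)"
    using min_degree_ge_split_degree [of "nat \<lfloor>x * real n\<rfloor>" n d l N j] assms
    by (auto simp: H_edges_def)
  have "G - 2 * \<delta> \<le> real (split_degree (l + 2) d N n (nat \<lfloor>x * real n\<rfloor>) i j)
      / real ((n - d) choose N)"
    using close [OF i(1)] G [OF i(1)] by linarith
  hence "(G - 2 * \<delta>) * real ((n - d) choose N)
      \<le> real (split_degree (l + 2) d N n (nat \<lfloor>x * real n\<rfloor>) i j)"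
    using B by (simp add: le_divide_eq)
  thus ?thesis using i(2) by linarith
qed

lemma max_min_degree_attained:
  assumes "l + 1 \<le> n"
  shows "\<exists>j\<le>l + 1. \<exists>x\<in>admissible k l j n. max_min_degree k d l n
    = min_degree d {..<n} (H_edges k l j n x)"
proof -
  have fin: "finite (admissible k l j n)" "admissible k l j n \<noteq> {}" for j
    using finite_admissible [of n k l j] admissible_near [OF assms, of 0 k j] assms by auto
  let ?D = "\<lambda>j x. min_degree d {..<n} (H_edges k l j n x)"
  have "max_min_degree k d l n \<in> (\<lambda>j. Max (?D j ` admissible k l j n)) ` {0..l + 1}"
    unfolding max_min_degree_def by (intro Max_in finite_imageI) simp_all
  then obtain j where j: "j \<in> {0..l + 1}" "max_min_degree k d l n = Max (?D j ` admissible k l j n)"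
    by blast
  have "Max (?D j ` admissible k l j n) \<in> ?D j ` admissible k l j n"
    using fin by (intro Max_in finite_imageI) simp_all
  then obtain x where "x \<in> admissible k l j n" "Max (?D j ` admissible k l j n) = ?D j x"
    by blast
  thus ?thesis using j by (intro exI [of _ j] conjI bexI [of _ x]) simp_all
qed

lemma max_min_degree_ge:
  assumes "l + 1 \<le> n" "j \<le> l + 1" "x \<in> admissible k l j n"
  shows "min_degree d {..<n} (H_edges k l j n x) \<le> max_min_degree k d l n"
proof -
  let ?D = "\<lambda>j x. min_degree d {..<n} (H_edges k l j n x)"
  have "?D j x \<le> Max (?D j ` admissible k l j n)"
    using assms finite_admissible [of n k l j] by (intro Max_ge) auto
  also have "\<dots> \<le> max_min_degree k d l n"
    unfolding max_min_degree_def using assms by (intro Max_ge) auto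
  finally show ?thesis .
qed

lemma eventually_uniformly_close:
  fixes f :: "real \<Rightarrow> real"
  assumes "continuous_on {0..1} f" "\<delta> > 0"
  shows "\<forall>\<^sub>F n in sequentially. \<forall>x\<in>{0..1}. \<forall>y\<in>{0..1}. \<bar>x - y\<bar> \<le> c / real n \<longrightarrow> \<bar>f x - f y\<bar> < \<delta>"
proof -
  have "uniformly_continuous_on {0..1} f"
    using assms by (intro compact_uniformly_continuous) auto
  then obtain \<eta> where \<eta>: "\<eta> > 0"
    "\<And>x y. x \<in> {0..1} \<Longrightarrow> y \<in> {0..1} \<Longrightarrow> dist y x < \<eta> \<Longrightarrow> dist (f y) (f x) < \<delta>"
    using assms(2) unfolding uniformly_continuous_on_def by blast
  have "\<forall>\<^sub>F n in sequentially. c / real n < \<eta>"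
    using order_tendstoD(2) [OF lim_const_over_n \<eta>(1)] .
  thus ?thesis
    by eventually_elim (use \<eta>(2) in \<open>auto simp: dist_real_def\<close>)
qed

text \<open>Any \<open>G\<close> with the two maximin properties is the limit: \<open>upper\<close>
  bounds whatever partition attains the maximum, and \<open>lower\<close> is transferred to an
  admissible point near \<open>x0\<close>.\<close>

lemma g_eq:
  assumes "1 \<le> d" "l < d + N" "j0 \<le> l + 1" "x0 \<in> {0..1}"
    and lower: "\<And>i. i \<le> d \<Longrightarrow> G \<le> residue_prob (l + 2) N i j0 x0"
    and upper: "\<And>j x. j \<le> l + 1 \<Longrightarrow> x \<in> {0..1} \<Longrightarrow> \<exists>i\<le>d. residue_prob (l + 2) N i j x \<le> G"
  shows "g (d + N) d l = G"
proof -
  let ?p = "residue_prob (l + 2) N"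
  let ?k = "d + N"
  let ?F = "inf sequentially (principal {n. [n = l] (mod ?k)})"
  have "((\<lambda>n. real (max_min_degree ?k d l n) / real ((n - d) choose N)) \<longlongrightarrow> G) ?F"
  proof (rule tendstoI)
    fix e :: real assume "e > 0"
    \<comment> \<open>Both estimates lose \<open>2 * \<delta>\<close>, which is less than
      \<open>e\<close>.\<close>
    define \<delta> where "\<delta> = e / 3"
    have "\<delta> > 0" using \<open>e > 0\<close> by (simp add: \<delta>_def)
    define R where "R = (\<lambda>n x i j. real (split_degree (l + 2) d N n (nat \<lfloor>x * real n\<rfloor>) i j)
        / real ((n - d) choose N))"
    have "\<forall>\<^sub>F n in sequentially. \<forall>i\<in>{..d}. \<forall>j\<in>{..l + 1}. \<forall>x\<in>{0..1}. dist (R n x i j) (?p i j x) < \<delta>"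
      unfolding R_def
      by (intro eventually_ball_finite [OF finite_atMost] ballI
            uniform_limitD [OF uniform_limit_split_degree \<open>\<delta> > 0\<close>])
    \<comment> \<open>The constant \<open>d + l + 2\<close> covers both the distance
      \<open>d / n\<close> to an endpoint and the distance \<open>(l + 2) / n\<close> to an
      admissible point.\<close>
    moreover have "\<forall>\<^sub>F n in sequentially. \<forall>i\<in>{..d}. \<forall>j\<in>{..l + 1}. \<forall>x\<in>{0..1}. \<forall>y\<in>{0..1}.
        \<bar>x - y\<bar> \<le> real (d + l + 2) / real n \<longrightarrow> \<bar>?p i j x - ?p i j y\<bar> < \<delta>"
      by (intro eventually_ball_finite [OF finite_atMost] ballI
            eventually_uniformly_close [OF continuous_on_residue_prob \<open>\<delta> > 0\<close>])
    moreover have "\<forall>\<^sub>F n in sequentially. 2 * d + N + l + 1 \<le> n"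
      by (rule eventually_ge_at_top)
    ultimately have "\<forall>\<^sub>F n in sequentially. [n = l] (mod ?k) \<longrightarrow>
        dist (real (max_min_degree ?k d l n) / real ((n - d) choose N)) G < e"
    proof eventually_elim
      case (elim n)
      let ?B = "real ((n - d) choose N)"
      have B: "?B > 0" using elim(3) by simp
      have close: "\<bar>R n x i j - ?p i j x\<bar> < \<delta>" if "i \<le> d" "j \<le> l + 1" "x \<in> {0..1}" for i j x
        using elim(1) that by (simp add: dist_real_def)
      have cont: "\<bar>?p i j x - ?p i j y\<bar> < \<delta>"
        if "i \<le> d" "j \<le> l + 1" "x \<in> {0..1}" "y \<in> {0..1}" "\<bar>x - y\<bar> \<le> real (d + l + 2) / real n"
        for i j x y
        using elim(2) that by simp
      have adm: "x \<in> {0..1}" if "x \<in> admissible ?k l j n" for x j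
        using that by (simp add: admissible_def)
      show ?case
      proof
        assume n: "[n = l] (mod ?k)"
        obtain j x where jx: "j \<le> l + 1" "x \<in> admissible ?k l j n"
          "max_min_degree ?k d l n = min_degree d {..<n} (H_edges ?k l j n x)"
          using max_min_degree_attained [of l n ?k d] elim(3) by auto
        have "real (max_min_degree ?k d l n) \<le> (G + 2 * \<delta>) * ?B"
          unfolding jx(3)
        proof (rule min_degree_H_le)
          show "2 * d \<le> n" "d + N \<le> n" using elim(3) by auto
          show "\<bar>real (split_degree (l + 2) d N n (nat \<lfloor>x * real n\<rfloor>) i j) / ?B - ?p i j x\<bar> < \<delta>"
            if "i \<le> d" for i
            using close [OF that jx(1) adm [OF jx(2)]] by (simp add: R_def)
        qed (use assms(1,2) n jx upper cont adm in blast)+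
        moreover obtain x where x: "x \<in> admissible ?k l j0 n" "\<bar>x - x0\<bar> \<le> real (l + 2) / real n"
          using admissible_near [of l n x0 ?k j0] assms elim(3) by auto
        have "(G - 2 * \<delta>) * ?B \<le> real (min_degree d {..<n} (H_edges ?k l j0 n x))"
        proof (rule min_degree_H_ge)
          show "d + N \<le> n" using elim(3) by auto
          show "x \<in> {0..1}" using adm x(1) .
          fix i assume "i \<le> d"
          show "\<bar>real (split_degree (l + 2) d N n (nat \<lfloor>x * real n\<rfloor>) i j0) / ?B - ?p i j0 x\<bar> < \<delta>"
            using close [OF \<open>i \<le> d\<close> assms(3) adm [OF x(1)]] by (simp add: R_def)
          have "real (l + 2) / real n \<le> real (d + l + 2) / real n"
            by (intro divide_right_mono) auto
          hence "\<bar>?p i j0 x - ?p i j0 x0\<bar> < \<delta>"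
            using x \<open>i \<le> d\<close> assms(3,4) adm by (intro cont) auto
          thus "G - \<delta> \<le> ?p i j0 x" using lower [OF \<open>i \<le> d\<close>] by linarith
        qed
        moreover have "min_degree d {..<n} (H_edges ?k l j0 n x) \<le> max_min_degree ?k d l n"
          using elim(3) assms(3) x(1) by (intro max_min_degree_ge) auto
        ultimately have "real (max_min_degree ?k d l n) / ?B \<le> G + 2 * \<delta>"
          "G - 2 * \<delta> \<le> real (max_min_degree ?k d l n) / ?B"
          using B by (simp_all add: divide_le_eq le_divide_eq)
        thus "dist (real (max_min_degree ?k d l n) / ?B) G < e"
          using \<open>e > 0\<close> by (simp add: dist_real_def \<delta>_def abs_less_iff)
      qed
    qed
    thus "\<forall>\<^sub>F n in ?F. dist (real (max_min_degree ?k d l n) / real ((n - d) choose N)) G < e"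
      by (simp add: eventually_inf_principal)
  qed
  \<comment> \<open>\<open>Lim\<close> is determined by convergence only along a nontrivial filter;
    the numbers \<open>n0 * k + l\<close> show that the residue class is unbounded.\<close>
  moreover have "?F \<noteq> bot"
  proof
    assume "?F = bot"
    hence "\<forall>\<^sub>F n in sequentially. \<not> [n = l] (mod ?k)"
      using eventually_inf_principal [of "\<lambda>_. False" sequentially "{n. [n = l] (mod ?k)}"]
      by simp
    then obtain n0 where "\<And>n. n \<ge> n0 \<Longrightarrow> \<not> [n = l] (mod ?k)"
      by (auto simp: eventually_sequentially)
    moreover have "n0 * ?k + l \<ge> n0" using assms(1) by (simp add: trans_le_add1)
    moreover have "[n0 * ?k + l = l] (mod ?k)" unfolding cong_def by (simp only: mod_mult_self3)
    ultimately show False by blast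
  qed
  ultimately show ?thesis unfolding g_def by (simp add: tendsto_Lim)
qed

section \<open>Bounds on \<open>g\<close>\<close>

text \<open>The interface for the final estimates: the inequalities at \<open>(j0, x0)\<close> bound
  \<open>g\<close> from above, and those for arbitrary \<open>(j, x)\<close> bound it from
  below.\<close>

lemma g_witnesses:
  assumes "1 \<le> d" "l < d + N"
  obtains j0 x0 where "j0 \<le> l + 1" "x0 \<in> {0..1}"
    "\<And>i. i \<le> d \<Longrightarrow> g (d + N) d l \<le> residue_prob (l + 2) N i j0 x0"
    "\<And>j x. j \<le> l + 1 \<Longrightarrow> x \<in> {0..1} \<Longrightarrow> \<exists>i\<le>d. residue_prob (l + 2) N i j x \<le> g (d + N) d l"
proof -
  from exists_max_min [of "residue_prob (l + 2) N" "l + 1" d]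
  obtain G j0 x0 where G: "j0 \<le> l + 1" "x0 \<in> {0..1}"
    "\<And>i. i \<le> d \<Longrightarrow> G \<le> residue_prob (l + 2) N i j0 x0"
    "\<And>j x. j \<le> l + 1 \<Longrightarrow> x \<in> {0..1} \<Longrightarrow> \<exists>i\<le>d. residue_prob (l + 2) N i j x \<le> G"
    using continuous_on_residue_prob by blast
  moreover have "g (d + N) d l = G" by (rule g_eq [OF assms G])
  ultimately show ?thesis using that by blast
qed

text \<open>The indices \<open>0, ..., D\<close> lie in distinct classes modulo
  \<open>l + 2\<close>, so \<open>D + 1\<close> disjoint events each have probability at least
  \<open>g\<close>. The theorem takes \<open>D = d\<close> or \<open>D = l + 1\<close>.\<close>

lemma g_le:
  assumes "1 \<le> d" "l < d + N" "D \<le> d" "D \<le> l + 1"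
  shows "g (d + N) d l \<le> 1 / (real D + 1)"
proof -
  obtain j0 x0 where *: "x0 \<in> {0..1}"
    "\<And>i. i \<le> d \<Longrightarrow> g (d + N) d l \<le> residue_prob (l + 2) N i j0 x0"
    using g_witnesses [OF assms(1,2)] by metis
  have "(\<Sum>i\<le>D. g (d + N) d l) \<le> (\<Sum>i\<le>D. residue_prob (l + 2) N i j0 x0)"
    using assms(3) * by (intro sum_mono) auto
  also have "\<dots> \<le> 1" using * assms(4) by (intro sum_residue_prob_le_1) auto
  finally show ?thesis by (simp add: field_simps)
qed

theorem proposition1p11:
  fixes k d l :: nat
  assumes "1 \<le> d" "d \<le> k - 1" "0 \<le> l" "l \<le> k - 1"
  shows "((d \<le> l + 1 \<longrightarrow> g k d l \<le> 1 / (real d + 1)) \<and>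
          (d \<ge> l + 1 \<longrightarrow> g k d l \<le> 1 / (real l + 2))) \<and>
         (d > 1 \<longrightarrow>
            real_of_int \<lfloor>(2 ^ (k - d) / 3 :: real)\<rfloor> * 2 powi (int d - int k) \<le> g k d 1 \<and>
            g k d 1 < 1 / 3)"
proof -
  define N where "N = k - d"
  have k: "k = d + N" "l < d + N" using assms by (auto simp: N_def)
  have "real_of_int \<lfloor>(2 ^ N / 3 :: real)\<rfloor> * 2 powi (int d - int k) \<le> g k d 1 \<and> g k d 1 < 1 / 3"
    if "d > 1"
  proof -
    \<comment> \<open>The second part has 1 in place of \<open>l\<close>, and \<open>d > 1\<close>
      supplies the condition that 1 is less than \<open>k\<close>.\<close>
    have "1 < d + N" using that by simp
    then obtain j0 x0 where *: "x0 \<in> {0..1}"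
      "\<And>i. i \<le> d \<Longrightarrow> g k d 1 \<le> residue_prob 3 N i j0 x0"
      "\<And>j x. j \<le> 2 \<Longrightarrow> x \<in> {0..1} \<Longrightarrow> \<exists>i\<le>d. residue_prob 3 N i j x \<le> g k d 1"
      using g_witnesses [OF assms(1), of 1 N] unfolding k(1)
      by (metis one_add_one numeral_Bit1 add.commute numeral_One)
    \<comment> \<open>Since \<open>d > 1\<close>, the indices 0, 1 and 2 all occur, so
      \<open>g\<close> is a lower bound for all three residues.\<close>
    have "g k d 1 < 1 / 3"
      using * that by (intro residue_prob_mod_3_lt [of _ N j0 x0]) auto
    \<comment> \<open>The balanced partition \<open>x = 1 / 2\<close> is tested; which
      \<open>i\<close> is obtained does not matter, as the floor bound holds for every
      index.\<close>
    moreover obtain i where "residue_prob 3 N i 0 (1 / 2) \<le> g k d 1"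
      using *(3) [of 0 "1 / 2"] by auto
    hence "real_of_int \<lfloor>2 ^ N / 3 :: real\<rfloor> / 2 ^ N \<le> g k d 1"
      by (rule order_trans [OF residue_prob_mod_3_half])
    moreover have "2 powi (int d - int k) = (1 / 2 ^ N :: real)"
      by (simp add: k(1) power_int_minus divide_inverse)
    ultimately show ?thesis by simp
  qed
  moreover have "g k d l \<le> 1 / (real d + 1)" if "d \<le> l + 1"
    using g_le [OF assms(1) k(2), of d] that by (simp add: k(1))
  moreover have "g k d l \<le> 1 / (real l + 2)" if "d \<ge> l + 1"
    using g_le [OF assms(1) k(2), of "l + 1"] that by (simp add: k(1) add.commute)
  ultimately show ?thesis by (simp add: N_def)
qed

end
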